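(* Let $F(\lambda)=\sum_{j=1}^k f_j(\lambda)F_j$ with $F_j\in\mathbb{C}^{n\times n}$ and scalar functions $f_j:\mathbb{C}\to\mathbb{C}$, and let $(\hat\lambda_i,\hat v_i)\in\mathbb{C}\times(\mathbb{C}^n\setminus\{0\})$, $i=1,\dots,p$, be approximate eigenpairs with backward error $\eta$ (defined in the context). Let $$G=\begin{bmatrix} f_1(\hat\lambda_1)&\cdots&f_k(\hat\lambda_1)\\ \vdots&&\vdots\\ f_1(\hat\lambda_p)&\cdots&f_k(\hat\lambda_p)\end{bmatrix}\in\mathbb{C}^{p\times k},\qquad V=\begin{bmatrix}\hat v_1&\cdots&\hat v_p\end{bmatrix}\in\mathbb{C}^{n\times p},\qquad \Lambda=\mathrm{diag}(\hat\lambda_1,\dots,\hat\lambda_p),$$ let $G\odot^T V^T$ be the Khatri-Rao transpose product of $G$ and $V^T$, and let $R=\sum_{j=1}^k F_jVf_j(\Lambda)$. Then $$\eta=\left\|R\left[(G\odot^T V^T)^\dagger\right]^T\right\|_F .$$ In particular, $\eta\le \sigma_{\hat p}(G\odot^T V^T)^{-1}\|R\|_F$, where $\hat p$ is the rank of $G\odot^T V^T$.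
   Context: The backward error of the approximate eigenpairs $(\hat\lambda_i,\hat v_i)$, $i=1,\dots,p$, is $$\eta:=\min\Big\{\|[\delta F_1,\dots,\delta F_k]\|_F \ :\ \delta F_j\in\mathbb{C}^{n\times n},\ \sum_{j=1}^k f_j(\hat\lambda_i)(F_j+\delta F_j)\hat v_i=0,\ 1\le i\le p\Big\}.$$ The approximate eigenpairs are arbitrary (no accuracy is required). For a $p\times k$ matrix $A$ and a $p\times n$ matrix $B$, the Khatri-Rao transpose product $A\odot^T B$ is the $p\times kn$ matrix whose $i$-th row is the Kronecker product of the $i$-th row of $A$ with the $i$-th row of $B$; so the $i$-th row of $G\odot^T V^T$ is $[f_1(\hat\lambda_i)\hat v_i^T,\dots,f_k(\hat\lambda_i)\hat v_i^T]$. Here $T$ is transposition without conjugation, $\dagger$ is the Moore-Penrose pseudoinverse, $\|\cdot\|_F$ is the Frobenius norm, $\sigma_1\ge\sigma_2\ge\cdots$ are singular values in non-increasing order, and $f_j(\Lambda)=\mathrm{diag}(f_j(\hat\lambda_1),\dots,f_j(\hat\lambda_p))$. The final bound is understood for $\hat p\ge 1$, i.e. $G\odot^T V^T\neq 0$. *)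

theory Defs
  imports
    Complex_Main
    "Jordan_Normal_Form.Schur_Decomposition"
    "Jordan_Normal_Form.DL_Rank"
begin

text \<open>All indices start at 0: the index ranges \<open>1..p\<close>, \<open>1..k\<close>, \<open>1..n\<close> become
  \<open>i < p\<close>, \<open>j < k\<close>, \<open>r < n\<close>. The exception is \<open>singular_value\<close>, which counts from 1.\<close>

definition frob_norm :: "complex mat \<Rightarrow> real" where
  "frob_norm A = sqrt (\<Sum>i<dim_row A. \<Sum>j<dim_col A. (cmod (A $$ (i, j)))\<^sup>2)"

text \<open>\<open>mat_adjoint\<close> is the conjugate transpose. The four Penrose equations determine at most one
  matrix of the given shape.\<close>

definition is_pseudoinverse :: "complex mat \<Rightarrow> complex mat \<Rightarrow> bool" where
  "is_pseudoinverse A X \<longleftrightarrow>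
     X \<in> carrier_mat (dim_col A) (dim_row A) \<and>
     A * X * A = A \<and>
     X * A * X = X \<and>
     mat_adjoint (A * X) = A * X \<and>
     mat_adjoint (X * A) = X * A"

definition pseudoinverse :: "complex mat \<Rightarrow> complex mat" where
  "pseudoinverse A = (THE X. is_pseudoinverse A X)"

text \<open>Square roots of the eigenvalues of \<open>A\<^sup>H A\<close> (roots of its characteristic polynomial with
  multiplicity, all real and nonnegative) in non-increasing order. If \<open>A\<close> has fewer rows than
  columns, the surplus eigenvalues, which all vanish, are cut off.\<close>

definition singular_values :: "complex mat \<Rightarrow> real list" where
  "singular_values A = take (min (dim_row A) (dim_col A))
     (rev (sorted_list_of_multiset
       (image_mset (\<lambda>z. sqrt (Re z)) (proots (char_poly (mat_adjoint A * A))))))"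

definition singular_value :: "complex mat \<Rightarrow> nat \<Rightarrow> real" where
  "singular_value A i = singular_values A ! (i - 1)"

definition mat_rank :: "complex mat \<Rightarrow> nat" where
  "mat_rank A = vec_space.rank (dim_row A) A"

definition kron_vec :: "complex vec \<Rightarrow> complex vec \<Rightarrow> complex vec" where
  "kron_vec a b = vec (dim_vec a * dim_vec b) (\<lambda>c. a $ (c div dim_vec b) * b $ (c mod dim_vec b))"

definition khatri_rao_T :: "complex mat \<Rightarrow> complex mat \<Rightarrow> complex mat" where
  "khatri_rao_T A B = mat_of_rows (dim_col A * dim_col B)
     (map (\<lambda>i. kron_vec (row A i) (row B i)) [0..<dim_row A])"

text \<open>The sum of the \<open>nr \<times> nc\<close> matrices \<open>A 0, \<dots>, A (k - 1)\<close>.\<close>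

definition mat_sum :: "nat \<Rightarrow> nat \<Rightarrow> nat \<Rightarrow> (nat \<Rightarrow> complex mat) \<Rightarrow> complex mat" where
  "mat_sum nr nc k A = mat nr nc (\<lambda>rc. \<Sum>j<k. A j $$ rc)"

text \<open>The block row \<open>[D 0, \<dots>, D (k - 1)]\<close> of \<open>n \<times> n\<close> matrices.\<close>

definition block_row :: "nat \<Rightarrow> nat \<Rightarrow> (nat \<Rightarrow> complex mat) \<Rightarrow> complex mat" where
  "block_row n k D = mat n (k * n) (\<lambda>(r, c). D (c div n) $$ (r, c mod n))"

text \<open>\<open>F(z) = \<Sum>j<k. f\<^sub>j(z) F\<^sub>j\<close>.\<close>

definition matrix_function ::
  "nat \<Rightarrow> nat \<Rightarrow> (nat \<Rightarrow> complex \<Rightarrow> complex) \<Rightarrow> (nat \<Rightarrow> complex mat) \<Rightarrow> complex \<Rightarrow> complex mat" where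
  "matrix_function n k f F z = mat_sum n n k (\<lambda>j. f j z \<cdot>\<^sub>m F j)"

text \<open>A scalar function of a diagonal matrix.\<close>

definition fun_of_diag :: "(complex \<Rightarrow> complex) \<Rightarrow> complex mat \<Rightarrow> complex mat" where
  "fun_of_diag g L = mat_diag (dim_row L) (\<lambda>i. g (L $$ (i, i)))"

definition perturbation_norms ::
  "nat \<Rightarrow> nat \<Rightarrow> nat \<Rightarrow> (nat \<Rightarrow> complex \<Rightarrow> complex) \<Rightarrow> (nat \<Rightarrow> complex mat) \<Rightarrow>
   (nat \<Rightarrow> complex) \<Rightarrow> (nat \<Rightarrow> complex vec) \<Rightarrow> real set" where
  "perturbation_norms n k p f F lam v =
     {frob_norm (block_row n k D) | D.
        (\<forall>j<k. D j \<in> carrier_mat n n) \<and>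
        (\<forall>i<p. matrix_function n k f (\<lambda>j. F j + D j) (lam i) *\<^sub>v v i = 0\<^sub>v n)}"

text \<open>\<open>LEAST\<close> is the minimum of an infinite set of reals here, so it is meaningful only if the
  minimum is attained.\<close>

definition backward_error ::
  "nat \<Rightarrow> nat \<Rightarrow> nat \<Rightarrow> (nat \<Rightarrow> complex \<Rightarrow> complex) \<Rightarrow> (nat \<Rightarrow> complex mat) \<Rightarrow>
   (nat \<Rightarrow> complex) \<Rightarrow> (nat \<Rightarrow> complex vec) \<Rightarrow> real" where
  "backward_error n k p f F lam v = (LEAST x. x \<in> perturbation_norms n k p f F lam v)"

end

(* With D = [dF_1, ..., dF_k], the eigenpair constraints are the linear equation D K^T = -R, where
   R = [F_1, ..., F_k] K^T; so D = -[F_1, ..., F_k] is admissible, and with the pseudoinverse X of K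
   so is -R X^T. Any admissible D satisfies -R X^T = D (X K)^T, and (X K)^T is an orthogonal
   projection, hence -R X^T has minimal Frobenius norm. For the bound, take a singular value
   decomposition K = Y S U^H; then |R X^T|_F = |R conj(Y) S^+|_F, where the nonzero entries of S^+ are
   at most 1 / sigma_r and |R conj(Y)|_F <= |R|_F because Y is a partial isometry. *)

theory Submission
  imports Defs
begin

section \<open>Adjoints and the Frobenius norm\<close>

text \<open>The decomposition comes from a spectral theorem for Hermitian matrices, applied to
  \<open>K^H K\<close>. It serves three ends: it shows that the pseudoinverse defined by
  \<open>THE\<close> exists, it computes \<open>mat_rank\<close>, and it ties the diagonal of the
  pseudoinverse to \<open>singular_value\<close>. The formula for \<eta> is then derived from the
  Penrose equations. As the pseudoinverse is transposed without conjugation, \<open>Y\<close> enters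
  the bound through its entrywise conjugate. Norms are compared through \<open>A A^H\<close>, whose
  diagonal holds the squared row norms, so that a right factor with orthonormal rows drops out by
  algebra alone.\<close>

lemma mat_adjoint_alt: "mat_adjoint A = mat (dim_col A) (dim_row A) (\<lambda>(i, j). cnj (A $$ (j, i)))"
  for A :: "complex mat"
  by (rule eq_matI) (auto simp: mat_adjoint_def mat_of_rows_def)

lemma mat_adjoint_dim [simp]:
  "dim_row (mat_adjoint A) = dim_col A" "dim_col (mat_adjoint A) = dim_row A"
  for A :: "complex mat"
  by (simp_all add: mat_adjoint_alt)

lemma mat_adjoint_index [simp]:
  "i < dim_col A \<Longrightarrow> j < dim_row A \<Longrightarrow> mat_adjoint A $$ (i, j) = cnj (A $$ (j, i))"
  for A :: "complex mat"
  by (simp add: mat_adjoint_alt)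

lemma mat_adjoint_carrier [simp]:
  "A \<in> carrier_mat m n \<Longrightarrow> mat_adjoint A \<in> carrier_mat n m" for A :: "complex mat"
  by (auto intro: carrier_matI)

lemma mat_adjoint_adjoint [simp]: "mat_adjoint (mat_adjoint A) = A" for A :: "complex mat"
  by (rule eq_matI) auto

lemma mat_adjoint_mult:
  "dim_col A = dim_row B \<Longrightarrow> mat_adjoint (A * B) = mat_adjoint B * mat_adjoint A"
  for A B :: "complex mat"
  by (rule eq_matI) (auto simp: scalar_prod_def mult.commute)

lemma mat_adjoint_diag: "mat_adjoint (mat_diag n f) = mat_diag n (\<lambda>i. cnj (f i))"
  by (rule eq_matI) (auto simp: mat_diag_def)

lemma mat_adjoint_transpose:
  "mat_adjoint (transpose_mat A) = transpose_mat (mat_adjoint A)" for A :: "complex mat"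
  by (rule eq_matI) auto

lemma transpose_diag: "transpose_mat (mat_diag n f) = mat_diag n f"
  by (rule eq_matI) (auto simp: mat_diag_def)

lemma transpose_mult': "dim_col A = dim_row B \<Longrightarrow>
    transpose_mat (A * B) = transpose_mat B * transpose_mat A" for A B :: "complex mat"
  by (rule transpose_mult) auto

lemma mult_mat_assoc: "dim_col A = dim_row B \<Longrightarrow> dim_col B = dim_row C \<Longrightarrow> (A * B) * C = A * (B * C)"
  for A B C :: "complex mat"
  by (rule assoc_mult_mat) auto

lemma mat_diag_dims [simp]: "dim_row (mat_diag n f) = n" "dim_col (mat_diag n f) = n"
  by (simp_all add: mat_diag_def)

text \<open>All side conditions are equations between dimensions, so that the simplifier can reassociate
  products without being told the carriers of the factors.\<close>

lemmas mat_algebra = mult_mat_assoc mat_adjoint_mult mat_adjoint_diag mat_adjoint_transpose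
  transpose_mult' transpose_diag

text \<open>Once \<open>mult_mat_assoc\<close> has moved all brackets to the right,
  \<open>A * B\<close> is no longer a subterm of \<open>A * (B * X)\<close>. Instances of this lemma
  let a known product still act as a rewrite rule.\<close>

lemma mult_mat_cancel:
  fixes A B C X :: "complex mat"
  assumes "A * B = C" "dim_col A = dim_row B" "dim_col B = dim_row X"
  shows "A * (B * X) = C * X"
  using assms by (metis mult_mat_assoc)

text \<open>The diagonal of \<open>A A^H\<close> lists the squared norms of the rows. The widths of
  \<open>A\<close> and \<open>B\<close> may differ, which allows comparing \<open>R * C\<close> with
  \<open>R * C * C^H\<close> later.\<close>

lemma frob_norm_cong:
  fixes A B :: "complex mat"
  assumes "A * mat_adjoint A = B * mat_adjoint B"
  shows "frob_norm A = frob_norm B"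
proof -
  have *: "(\<Sum>j<dim_col A. (cmod (A $$ (i, j)))\<^sup>2) = Re ((A * mat_adjoint A) $$ (i, i))"
    if "i < dim_row A" for i and A :: "complex mat"
    using that
    by (simp add: scalar_prod_def atLeast0LessThan flip: complex_norm_square of_real_power)
  have "dim_row A = dim_row B"
    using arg_cong[OF assms, of dim_row] by simp
  then show ?thesis
    unfolding frob_norm_def by (auto simp: * assms intro!: sum.cong)
qed

lemma frob_norm_mono:
  assumes "dim_row A = dim_row B" "dim_col A = dim_col B"
    "\<And>i j. i < dim_row B \<Longrightarrow> j < dim_col B \<Longrightarrow> cmod (A $$ (i, j)) \<le> c * cmod (B $$ (i, j))" "0 \<le> c"
  shows "frob_norm A \<le> c * frob_norm B"
proof -
  have "frob_norm A \<le> sqrt (\<Sum>i<dim_row B. \<Sum>j<dim_col B. (c * cmod (B $$ (i, j)))\<^sup>2)"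
    unfolding frob_norm_def assms(1,2)
    by (intro real_sqrt_le_mono sum_mono power_mono assms(3)) auto
  also have "\<dots> = c * frob_norm B"
    using \<open>0 \<le> c\<close> by (simp add: frob_norm_def power_mult_distrib real_sqrt_mult flip: sum_distrib_left)
  finally show ?thesis .
qed

text \<open>Pythagoras in each row: for a row \<open>a\<close> of \<open>A\<close> and
  \<open>b = a P\<close>, the hypotheses on \<open>P\<close> give \<open><b, b> = <b, a>\<close>,
  hence \<open>0 <= |a - b|^2 = |a|^2 - |b|^2\<close>.\<close>

lemma frob_norm_projection_le:
  fixes A P :: "complex mat"
  assumes A: "A \<in> carrier_mat n m" and P: "P \<in> carrier_mat m m"
    and proj: "P * P = P" "mat_adjoint P = P"
  shows "frob_norm (A * P) \<le> frob_norm A"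
proof -
  let ?B = "A * P"
  note dims = carrier_matD[OF A] carrier_matD[OF P]
  have "(\<Sum>j<m. (cmod (?B $$ (i, j)))\<^sup>2) \<le> (\<Sum>j<m. (cmod (A $$ (i, j)))\<^sup>2)" if "i < n" for i
  proof -
    define a b where "a = (\<lambda>j. A $$ (i, j))" and "b = (\<lambda>j. ?B $$ (i, j))"
    have "(\<Sum>j<m. b j * cnj (b j)) = (?B * mat_adjoint ?B) $$ (i, i)"
      using dims that by (simp add: b_def scalar_prod_def atLeast0LessThan)
    \<comment> \<open>With \<open>B\<close> for \<open>?B\<close>:
      \<open>B B^H = A P P^H A^H = A P A^H = B A^H\<close>.\<close>
    also have "\<dots> = (?B * mat_adjoint A) $$ (i, i)"
      using dims proj(2) by (simp add: mat_algebra mult_mat_cancel[OF proj(1)])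
    also have "\<dots> = (\<Sum>j<m. b j * cnj (a j))"
      using dims that by (simp add: a_def b_def scalar_prod_def atLeast0LessThan)
    finally have "Re (\<Sum>j<m. b j * cnj (b j)) = Re (\<Sum>j<m. b j * cnj (a j))"
      by simp
    then have eq: "(\<Sum>j<m. (cmod (b j))\<^sup>2) = (\<Sum>j<m. Re (b j * cnj (a j)))"
      by (simp flip: complex_norm_square of_real_power)
    have "0 \<le> (\<Sum>j<m. (cmod (a j - b j))\<^sup>2)"
      by (rule sum_nonneg) auto
    also have "\<dots> = (\<Sum>j<m. (cmod (a j))\<^sup>2 + (cmod (b j))\<^sup>2 - 2 * Re (b j * cnj (a j)))"
      by (rule sum.cong[OF refl], simp only: cmod_power2) (simp add: power2_eq_square algebra_simps)
    also have "\<dots> = (\<Sum>j<m. (cmod (a j))\<^sup>2) - (\<Sum>j<m. (cmod (b j))\<^sup>2)"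
      by (simp add: sum.distrib sum_subtractf eq flip: sum_distrib_left)
    finally show ?thesis
      by (simp add: a_def b_def)
  qed
  then have "(\<Sum>i<n. \<Sum>j<m. (cmod (?B $$ (i, j)))\<^sup>2) \<le> (\<Sum>i<n. \<Sum>j<m. (cmod (A $$ (i, j)))\<^sup>2)"
    by (rule sum_mono) simp
  then show ?thesis
    unfolding frob_norm_def using dims by (simp del: index_mult_mat(1))
qed

section \<open>Spectral theorem for Hermitian matrices\<close>

text \<open>Gram-Schmidt on a basis that starts with \<open>v\<close> keeps \<open>v\<close> in
  front. Its output is orthogonal but not normalised, so the columns are divided by their lengths
  \<open>N j\<close>, and \<open>c\<close> is \<open>1 / N 0\<close>.\<close>

lemma ex_unitary_with_first_col:
  fixes v :: "complex vec"
  assumes v: "v \<in> carrier_vec n" "v \<noteq> 0\<^sub>v n"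
  shows "\<exists>W c. W \<in> carrier_mat n n \<and> mat_adjoint W * W = 1\<^sub>m n \<and> W * mat_adjoint W = 1\<^sub>m n \<and>
           col W 0 = c \<cdot>\<^sub>v v"
proof -
  interpret cof_vec_space n "TYPE(complex)" .
  define ws where "ws = gram_schmidt n (basis_completion v)"
  note b = basis_completion[OF v]
  have ws: "corthogonal ws" "set ws \<subseteq> carrier_vec n" "length ws = n"
    using gram_schmidt_result[OF b(2,4,5) refl] b(6) by (simp_all add: ws_def)
  have "n \<noteq> 0" using v by auto
  have "basis_completion v \<noteq> []"
    using b(6) \<open>n \<noteq> 0\<close> by auto
  with b(7) have "basis_completion v = v # tl (basis_completion v)"
    by (metis list.collapse)
  then have "hd ws = v"
    using gram_schmidt_hd[OF v(1)] unfolding ws_def by metis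
  with \<open>n \<noteq> 0\<close> ws(3) have ws0: "ws ! 0 = v"
    by (metis hd_conv_nth list.size(3))
  have ws_carrier: "ws ! j \<in> carrier_vec n" if "j < n" for j
    using ws that by auto
  define N where "N j = sqrt (\<Sum>k<n. (cmod (ws ! j $ k))\<^sup>2)" for j
  have sprod: "(\<Sum>k<n. ws ! j $ k * cnj (ws ! i $ k)) = (if i = j then (of_real (N j))\<^sup>2 else 0)"
    if "i < n" "j < n" for i j
  proof -
    have "(\<Sum>k<n. ws ! j $ k * cnj (ws ! i $ k)) = ws ! j \<bullet>c ws ! i"
      using ws_carrier[OF that(1)] by (simp add: scalar_prod_def atLeast0LessThan)
    moreover have "ws ! j \<bullet>c ws ! i = 0" if "i \<noteq> j"
      using corthogonalD[OF ws(1)] \<open>i < n\<close> \<open>j < n\<close> ws(3) that by auto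
    moreover have "(\<Sum>k<n. ws ! j $ k * cnj (ws ! j $ k)) = (of_real (N j))\<^sup>2"
      by (simp add: N_def sum_nonneg flip: complex_norm_square of_real_power of_real_sum)
    ultimately show ?thesis
      by auto
  qed
  \<comment> \<open>\<open>corthogonal\<close> also demands that each vector have a nonzero product
    with itself.\<close>
  have N: "N j \<noteq> 0" if "j < n" for j
  proof
    assume "N j = 0"
    then have "ws ! j \<bullet>c ws ! j = 0"
      using sprod[OF that that] ws_carrier[OF that] by (simp add: scalar_prod_def atLeast0LessThan)
    then show False
      using corthogonalD[OF ws(1)] that ws(3) by auto
  qed
  define W where "W = mat n n (\<lambda>(i, j). ws ! j $ i / of_real (N j))"
  have W: "W \<in> carrier_mat n n" by (simp add: W_def)
  have "mat_adjoint W * W = 1\<^sub>m n"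
  proof (rule eq_matI)
    fix i j assume "i < dim_row (1\<^sub>m n :: complex mat)" "j < dim_col (1\<^sub>m n :: complex mat)"
    then have ij: "i < n" "j < n" by auto
    have "(mat_adjoint W * W) $$ (i, j)
        = (\<Sum>k<n. ws ! j $ k * cnj (ws ! i $ k)) / (of_real (N i) * of_real (N j))"
      using ij by (auto simp: W_def scalar_prod_def atLeast0LessThan sum_divide_distrib intro!: sum.cong)
    then show "(mat_adjoint W * W) $$ (i, j) = 1\<^sub>m n $$ (i, j)"
      using ij N by (simp add: sprod[OF ij] power2_eq_square)
  qed (use W in auto)
  moreover from this have "W * mat_adjoint W = 1\<^sub>m n"
    using mat_mult_left_right_inverse[of "mat_adjoint W" n W] W by simp
  moreover have "col W 0 = (1 / of_real (N 0)) \<cdot>\<^sub>v v"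
    using \<open>n \<noteq> 0\<close> v(1) by (intro eq_vecI) (auto simp: W_def ws0)
  ultimately show ?thesis
    using W by blast
qed

text \<open>Induction by deflation: a unitary \<open>W\<close> whose first column is an eigenvector
  turns \<open>M\<close> into a block diagonal matrix with blocks \<open>e\<close> and
  \<open>B'\<close>, and the induction hypothesis diagonalises \<open>B'\<close>. That the
  eigenvalues are real and nonnegative in the case of \<open>A^H A\<close> emerges in
  \<open>svd_exists\<close>.\<close>

theorem hermitian_spectral:
  fixes M :: "complex mat"
  assumes "M \<in> carrier_mat n n" "mat_adjoint M = M"
  shows "\<exists>U d. U \<in> carrier_mat n n \<and> mat_adjoint U * U = 1\<^sub>m n \<and> U * mat_adjoint U = 1\<^sub>m n \<and>
           M = U * mat_diag n d * mat_adjoint U"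
  using assms
proof (induction n arbitrary: M)
  case 0
  then show ?case
    by (intro exI[of _ "1\<^sub>m 0"] exI[of _ "\<lambda>_. 0"] conjI eq_matI) auto
next
  case (Suc n)
  note M = Suc.prems
  obtain as where as: "char_poly M = (\<Prod>a\<leftarrow>as. [:- a, 1:])" "length as = Suc n"
    using char_poly_factorized[OF M(1)] by auto
  then obtain e where "poly (char_poly M) e = 0"
    by (cases as) auto
  then have "eigenvalue M e"
    using eigenvalue_root_char_poly[OF M(1)] by simp
  then obtain v where v: "v \<in> carrier_vec (Suc n)" "v \<noteq> 0\<^sub>v (Suc n)" "M *\<^sub>v v = e \<cdot>\<^sub>v v"
    using M(1) by (auto simp: eigenvalue_def eigenvector_def)
  obtain W c where W: "W \<in> carrier_mat (Suc n) (Suc n)"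
    and WW: "mat_adjoint W * W = 1\<^sub>m (Suc n)" "W * mat_adjoint W = 1\<^sub>m (Suc n)"
    and col0: "col W 0 = c \<cdot>\<^sub>v v"
    using ex_unitary_with_first_col[OF v(1,2)] by auto
  note dims = carrier_matD[OF M(1)] carrier_matD[OF W]
  define B where "B = mat_adjoint W * M * W"
  have B: "B \<in> carrier_mat (Suc n) (Suc n)"
    using dims by (intro carrier_matI) (simp_all add: B_def)
  have adjB: "mat_adjoint B = B"
    using dims M(2) by (simp add: B_def mat_algebra)
  \<comment> \<open>For the first column \<open>w\<close> of \<open>W\<close>, the first column of
    \<open>B\<close> is \<open>W^H M w = e W^H w\<close>, and \<open>W^H w\<close> is the first unit
    vector because \<open>W^H W = 1\<close>.\<close>
  have "col B 0 = mat_adjoint W *\<^sub>v (M *\<^sub>v col W 0)"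
    unfolding B_def assoc_mult_mat[OF mat_adjoint_carrier[OF W] M(1) W]
    by (simp only: col_mult2[OF mat_adjoint_carrier[OF W] mult_carrier_mat[OF M(1) W] zero_less_Suc]
        col_mult2[OF M(1) W zero_less_Suc])
  also have "M *\<^sub>v col W 0 = e \<cdot>\<^sub>v col W 0"
    using M(1) v by (simp add: col0 mult_mat_vec[of _ "Suc n" "Suc n"] smult_smult_assoc mult.commute)
  also have "mat_adjoint W *\<^sub>v (e \<cdot>\<^sub>v col W 0) = e \<cdot>\<^sub>v col (mat_adjoint W * W) 0"
    using W by (subst mult_mat_vec[of _ "Suc n" "Suc n"])
      (auto simp: col_mult2[of _ "Suc n" "Suc n" _ "Suc n"] intro!: col_carrier_vec)
  finally have colB: "col B 0 = e \<cdot>\<^sub>v col (1\<^sub>m (Suc n)) 0"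
    by (simp add: WW)
  have B_col: "B $$ (i, 0) = (if i = 0 then e else 0)" if "i < Suc n" for i
    using arg_cong[OF colB, of "\<lambda>u. u $ i"] that B by auto
  \<comment> \<open>Hermitian symmetry carries the zeros of the first column over to the first
    row.\<close>
  have B_row: "B $$ (0, i) = 0" if "i < Suc n" "i \<noteq> 0" for i
  proof -
    have "B $$ (0, i) = mat_adjoint B $$ (0, i)" by (simp add: adjB)
    then show ?thesis using that B B_col by auto
  qed
  define B' where "B' = mat n n (\<lambda>(i, j). B $$ (Suc i, Suc j))"
  have B': "B' \<in> carrier_mat n n" by (simp add: B'_def)
  have "mat_adjoint B' = B'"
  proof (rule eq_matI)
    fix i j assume "i < dim_row B'" "j < dim_col B'"
    then have "i < n" "j < n" by (simp_all add: B'_def)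
    then show "mat_adjoint B' $$ (i, j) = B' $$ (i, j)"
      using B arg_cong[OF adjB, of "\<lambda>A. A $$ (Suc i, Suc j)"] by (simp add: B'_def)
  qed (simp_all add: B'_def)
  then obtain U' d' where U': "U' \<in> carrier_mat n n"
    and UU': "mat_adjoint U' * U' = 1\<^sub>m n" "U' * mat_adjoint U' = 1\<^sub>m n"
    and B'_eq: "B' = U' * mat_diag n d' * mat_adjoint U'"
    using Suc.IH[OF B'] by blast
  define Q where "Q = four_block_mat (1\<^sub>m 1) (0\<^sub>m 1 n) (0\<^sub>m n 1) U'"
  define d where "d = case_nat e d'"
  have Q: "Q \<in> carrier_mat (Suc n) (Suc n)"
    using U' by (auto simp: Q_def)
  have adjQ: "mat_adjoint Q = four_block_mat (1\<^sub>m 1) (0\<^sub>m 1 n) (0\<^sub>m n 1) (mat_adjoint U')"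
    by (rule eq_matI) (use U' in \<open>auto simp: Q_def\<close>)
  have one: "1\<^sub>m (Suc n) = four_block_mat (1\<^sub>m 1) (0\<^sub>m 1 n) (0\<^sub>m n 1) (1\<^sub>m n :: complex mat)"
    by (rule eq_matI) auto
  have diag: "mat_diag (Suc n) d = four_block_mat (mat 1 1 (\<lambda>_. e)) (0\<^sub>m 1 n) (0\<^sub>m n 1) (mat_diag n d')"
    by (rule eq_matI) (auto simp: mat_diag_def d_def split: nat.split)
  have B_eq: "B = four_block_mat (mat 1 1 (\<lambda>_. e)) (0\<^sub>m 1 n) (0\<^sub>m n 1) B'"
    by (rule eq_matI) (use B B_row B_col in \<open>auto simp: B'_def\<close>)
  have QQ: "mat_adjoint Q * Q = 1\<^sub>m (Suc n)"
    unfolding adjQ unfolding Q_def one using U' UU'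
    by (subst mult_four_block_mat[of _ 1 1 _ n _ n _ _ 1 _ n]) auto
  then have QQ': "Q * mat_adjoint Q = 1\<^sub>m (Suc n)"
    using mat_mult_left_right_inverse[of "mat_adjoint Q" "Suc n" Q] Q by auto
  have BQ: "B = Q * mat_diag (Suc n) d * mat_adjoint Q"
    unfolding adjQ unfolding Q_def diag B_eq B'_eq using U'
    by (subst mult_four_block_mat[of _ 1 1 _ n _ n _ _ 1 _ n],
        simp_all, subst mult_four_block_mat[of _ 1 1 _ n _ n _ _ 1 _ n], auto)
  note dims = dims carrier_matD[OF Q]
  have "W * B * mat_adjoint W = M"
    unfolding B_def using dims by (simp add: mat_algebra WW mult_mat_cancel[OF WW(2)])
  then have "M = (W * Q) * mat_diag (Suc n) d * mat_adjoint (W * Q)"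
    using dims by (simp add: mat_algebra BQ)
  moreover have "mat_adjoint (W * Q) * (W * Q) = 1\<^sub>m (Suc n)"
    using dims by (simp add: mat_algebra mult_mat_cancel[OF WW(1)] QQ)
  moreover have "(W * Q) * mat_adjoint (W * Q) = 1\<^sub>m (Suc n)"
    using dims by (simp add: mat_algebra mult_mat_cancel[OF QQ'] WW)
  ultimately show ?case
    using W Q by (intro exI[of _ "W * Q"] exI[of _ d]) auto
qed

section \<open>Singular value decomposition and pseudoinverse\<close>

text \<open>Both \<open>A X\<close> and \<open>A Y\<close> are the orthogonal projection onto the
  range of \<open>A\<close>: \<open>A X = (A Y) (A X)\<close> is the adjoint of
  \<open>(A X) (A Y) = A Y\<close>, which is Hermitian. Likewise \<open>X A = Y A\<close>, so
  \<open>X = X A X = Y A X = Y A Y = Y\<close>.\<close>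

lemma is_pseudoinverse_unique:
  assumes X: "is_pseudoinverse A X" and Y: "is_pseudoinverse A Y"
  shows "X = Y"
proof -
  have dims: "dim_row X = dim_col A" "dim_col X = dim_row A" "dim_row Y = dim_col A" "dim_col Y = dim_row A"
    using assms by (auto simp: is_pseudoinverse_def)
  note x = X[unfolded is_pseudoinverse_def] and y = Y[unfolded is_pseudoinverse_def]
  have "A * X = (A * Y) * (A * X)"
    using dims x y by (metis mult_mat_assoc index_mult_mat(2,3))
  also have "\<dots> = mat_adjoint ((A * X) * (A * Y))"
    using dims x y by (simp add: mat_adjoint_mult del: index_mult_mat(1))
  also have "(A * X) * (A * Y) = A * Y"
    using dims x y by (metis mult_mat_assoc index_mult_mat(2,3))
  finally have AX: "A * X = A * Y"
    using y by simp
  have "X * A = (X * A) * (Y * A)"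
    using dims x y by (metis mult_mat_assoc index_mult_mat(2,3))
  also have "\<dots> = mat_adjoint ((Y * A) * (X * A))"
    using dims x y by (simp add: mat_adjoint_mult del: index_mult_mat(1))
  also have "(Y * A) * (X * A) = Y * A"
    using dims x y by (metis mult_mat_assoc index_mult_mat(2,3))
  finally have XA: "X * A = Y * A"
    using y by simp
  have "X = X * (A * X)"
    using dims x by (metis mult_mat_assoc)
  also have "\<dots> = Y * (A * Y)"
    using dims by (metis AX XA mult_mat_assoc)
  finally show ?thesis
    using dims y by (metis mult_mat_assoc)
qed

lemma pseudoinverseI: "is_pseudoinverse A X \<Longrightarrow> pseudoinverse A = X"
  unfolding pseudoinverse_def using is_pseudoinverse_unique by blast

lemma proots_linear_factors: "proots (\<Prod>a\<leftarrow>as. [:- a, 1:]) = mset as" for as :: "complex list"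
proof (induction as)
  case (Cons a as)
  have "(\<Prod>a\<leftarrow>as. [:- a, 1:]) \<noteq> 0"
    by (auto simp: prod_list_zero_iff)
  with Cons show ?case
    by (simp add: proots_mult del: mult_pCons_left)
qed simp

text \<open>The singular values are not sorted, and the columns of \<open>Y\<close> for vanishing singular values
  are zero, so \<open>Y\<close> is a partial isometry and need not be completed to a unitary matrix.\<close>

locale svd =
  fixes m n :: nat and A Y U :: "complex mat" and s :: "nat \<Rightarrow> real"
  assumes A: "A \<in> carrier_mat m n" and Y: "Y \<in> carrier_mat m n" and U: "U \<in> carrier_mat n n"
    and s_nonneg: "\<And>i. i < n \<Longrightarrow> 0 \<le> s i"
    and UU: "mat_adjoint U * U = 1\<^sub>m n" "U * mat_adjoint U = 1\<^sub>m n"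
    and YY: "mat_adjoint Y * Y = mat_diag n (\<lambda>i. of_bool (s i \<noteq> 0))"
    and YE: "Y * mat_diag n (\<lambda>i. of_bool (s i \<noteq> 0)) = Y"
    and A_eq: "A = Y * mat_diag n (\<lambda>i. of_real (s i)) * mat_adjoint U"

text \<open>Diagonalising \<open>A^H A\<close> by \<open>U\<close> makes the columns of
  \<open>W = A U\<close> pairwise orthogonal. Their lengths are the \<open>s i\<close>, and the
  nonzero columns, normalised, give \<open>Y\<close>.\<close>

theorem svd_exists:
  fixes A :: "complex mat"
  assumes A: "A \<in> carrier_mat m n"
  shows "\<exists>Y U s. svd m n A Y U s"
proof -
  let ?M = "mat_adjoint A * A"
  have "?M \<in> carrier_mat n n" "mat_adjoint ?M = ?M"
    using A by (auto simp: mat_algebra)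
  then obtain U d where U: "U \<in> carrier_mat n n"
    and UU: "mat_adjoint U * U = 1\<^sub>m n" "U * mat_adjoint U = 1\<^sub>m n"
    and M: "?M = U * mat_diag n d * mat_adjoint U"
    using hermitian_spectral by blast
  note dims = carrier_matD[OF A] carrier_matD[OF U]
  define W where "W = A * U"
  have W: "W \<in> carrier_mat m n"
    using A U by (simp add: W_def)
  have "mat_adjoint W * W = mat_adjoint U * (?M * U)"
    using dims by (simp add: W_def mat_algebra)
  also have "\<dots> = mat_diag n d"
    using dims by (simp only: M) (simp add: mat_algebra UU mult_mat_cancel[OF UU(1)])
  finally have WW: "mat_adjoint W * W = mat_diag n d" .
  have WW_index: "(\<Sum>k<m. W $$ (k, j) * cnj (W $$ (k, i))) = (if i = j then d j else 0)"
    if "i < n" "j < n" for i j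
    using that W arg_cong[OF WW, of "\<lambda>A. A $$ (i, j)"]
    by (simp add: scalar_prod_def atLeast0LessThan mat_diag_def mult.commute)
  define s where "s i = sqrt (\<Sum>k<m. (cmod (W $$ (k, i)))\<^sup>2)" for i
  have d: "d i = (of_real (s i))\<^sup>2" if "i < n" for i
    using WW_index[OF that that]
    by (simp add: s_def sum_nonneg flip: complex_norm_square of_real_power of_real_sum)
  have W0: "W $$ (k, i) = 0" if "k < m" "i < n" "s i = 0" for k i
    using that by (simp add: s_def sum_nonneg_eq_0_iff)
  \<comment> \<open>Division by zero yields 0, so \<open>s i = 0\<close> produces a zero column of
    \<open>Y\<close>; by \<open>W0\<close> the identity \<open>Y S = W\<close> holds in that column
    as well.\<close>
  define Y where "Y = mat m n (\<lambda>(k, i). W $$ (k, i) / of_real (s i))"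
  have Y: "Y \<in> carrier_mat m n" by (simp add: Y_def)
  have YS: "Y * mat_diag n (\<lambda>i. of_real (s i)) = W"
    unfolding mat_diag_mult_right[OF Y] by (rule eq_matI) (use W in \<open>auto simp: Y_def W0\<close>)
  have "mat_adjoint Y * Y = mat_diag n (\<lambda>i. of_bool (s i \<noteq> 0))"
  proof (rule eq_matI)
    fix i j assume "i < dim_row (mat_diag n (\<lambda>i. of_bool (s i \<noteq> 0)) :: complex mat)"
      "j < dim_col (mat_diag n (\<lambda>i. of_bool (s i \<noteq> 0)) :: complex mat)"
    then have ij: "i < n" "j < n" by auto
    have "(mat_adjoint Y * Y) $$ (i, j)
        = (\<Sum>k<m. W $$ (k, j) * cnj (W $$ (k, i))) / (of_real (s i) * of_real (s j))"
      using ij by (auto simp: Y_def scalar_prod_def atLeast0LessThan sum_divide_distrib intro!: sum.cong)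
    then show "(mat_adjoint Y * Y) $$ (i, j) = mat_diag n (\<lambda>i. of_bool (s i \<noteq> 0)) $$ (i, j)"
      using ij by (simp add: WW_index[OF ij] d mat_diag_def power2_eq_square)
  qed (use Y in auto)
  moreover have "Y * mat_diag n (\<lambda>i. of_bool (s i \<noteq> 0)) = Y"
    unfolding mat_diag_mult_right[OF Y] by (rule eq_matI) (auto simp: Y_def)
  moreover have "A = Y * mat_diag n (\<lambda>i. of_real (s i)) * mat_adjoint U"
    using dims by (simp add: YS W_def mat_algebra UU)
  ultimately show ?thesis
    using A Y U UU by (intro exI[of _ Y] exI[of _ U] exI[of _ s]) (simp add: svd_def s_def sum_nonneg)
qed

context svd begin

lemmas dims = carrier_matD[OF A] carrier_matD[OF Y] carrier_matD[OF U]

text \<open>Since \<open>inverse 0 = 0\<close>, \<open>?T\<close> is the pseudoinverse of the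
  diagonal matrix \<open>?S\<close>, and their product \<open>?E\<close> selects the indices with
  \<open>s i \<noteq> 0\<close>. The products \<open>A X\<close> and \<open>X A\<close> become
  \<open>Y Y^H\<close> and \<open>U E U^H\<close>, visibly Hermitian.\<close>

lemma pseudoinverse_eq:
  "pseudoinverse A = U * mat_diag n (\<lambda>i. inverse (of_real (s i))) * mat_adjoint Y" (is "_ = ?X")
  and is_pseudoinverse: "is_pseudoinverse A (pseudoinverse A)"
proof -
  let ?S = "mat_diag n (\<lambda>i. complex_of_real (s i))"
    and ?T = "mat_diag n (\<lambda>i. inverse (complex_of_real (s i)))"
    and ?E = "mat_diag n (\<lambda>i. of_bool (s i \<noteq> 0)) :: complex mat"
  have mult: "?S * ?T = ?E" "?T * ?S = ?E" "?E * ?S = ?S" "?E * ?T = ?T"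
    unfolding mat_diag_diag by (auto intro!: arg_cong[of _ _ "mat_diag n"])
  note c = mult_mat_cancel[OF mult(1)] mult_mat_cancel[OF mult(2)] mult_mat_cancel[OF mult(3)]
    mult_mat_cancel[OF mult(4)] mult_mat_cancel[OF UU(1)] mult_mat_cancel[OF YY] mult_mat_cancel[OF YE]
  have adjs: "mat_adjoint ?S = ?S" "mat_adjoint ?T = ?T" "mat_adjoint ?E = ?E"
    by (auto simp: mat_adjoint_diag of_bool_def intro!: arg_cong[of _ _ "mat_diag n"])
  have EY: "?E * mat_adjoint Y = mat_adjoint Y"
    using arg_cong[OF YE, of mat_adjoint] dims by (simp add: mat_adjoint_mult adjs)
  have AX: "A * ?X = Y * mat_adjoint Y" and XA: "?X * A = U * (?E * mat_adjoint U)"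
    using dims by (simp_all add: A_eq mult_mat_assoc c EY mult UU YY YE del: mat_diag_diag)
  have "is_pseudoinverse A ?X"
    unfolding is_pseudoinverse_def AX XA
  proof (intro conjI)
    show "?X \<in> carrier_mat (dim_col A) (dim_row A)"
      using dims by (intro carrier_matI) simp_all
    show "Y * mat_adjoint Y * A = A"
      using dims by (simp add: A_eq mult_mat_assoc c EY mult UU YY YE del: mat_diag_diag)
    show "U * (?E * mat_adjoint U) * ?X = ?X"
      using dims by (simp add: mult_mat_assoc c EY mult UU YY YE del: mat_diag_diag)
    show "mat_adjoint (Y * mat_adjoint Y) = Y * mat_adjoint Y"
      using dims by (simp add: mat_adjoint_mult)
    show "mat_adjoint (U * (?E * mat_adjoint U)) = U * (?E * mat_adjoint U)"
      using dims by (simp add: mat_adjoint_mult mult_mat_assoc adjs)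
  qed
  then show "pseudoinverse A = ?X" "is_pseudoinverse A (pseudoinverse A)"
    using pseudoinverseI by auto
qed

text \<open>In \<open>A^H A = U S (Y^H Y) S U^H\<close> the middle factor is absorbed by
  \<open>S\<close>, because its diagonal vanishes only where \<open>s i = 0\<close>. Unitary
  similarity then reduces to a diagonal matrix.\<close>

lemma proots_char_poly_gram: "proots (char_poly (mat_adjoint A * A)) =
    image_mset (\<lambda>i. of_real ((s i)\<^sup>2)) (mset_set {..<n})"
proof -
  let ?D = "mat_diag n (\<lambda>i. complex_of_real ((s i)\<^sup>2))"
  have "mat_adjoint A * A = U * ?D * mat_adjoint U"
  proof -
    have "mat_adjoint A * A = U * (mat_diag n (\<lambda>i. of_real (s i))
        * (mat_diag n (\<lambda>i. of_bool (s i \<noteq> 0)) * (mat_diag n (\<lambda>i. of_real (s i)) * mat_adjoint U)))"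
      using dims by (simp add: A_eq mult_mat_assoc mat_adjoint_mult mat_adjoint_diag mult_mat_cancel[OF YY])
    also have "\<dots> = U * ((mat_diag n (\<lambda>i. of_real (s i)) * mat_diag n (\<lambda>i. of_bool (s i \<noteq> 0))
        * mat_diag n (\<lambda>i. of_real (s i))) * mat_adjoint U)"
      using dims by (simp only: mult_mat_assoc mat_diag_dims mat_adjoint_dim index_mult_mat(2,3))
    also have "mat_diag n (\<lambda>i. of_real (s i)) * mat_diag n (\<lambda>i. of_bool (s i \<noteq> 0))
        * mat_diag n (\<lambda>i. complex_of_real (s i)) = ?D"
      unfolding mat_diag_diag by (auto intro!: arg_cong[of _ _ "mat_diag n"] simp: power2_eq_square)
    finally show ?thesis
      using dims by (simp add: mult_mat_assoc)
  qed
  then have "similar_mat (mat_adjoint A * A) ?D"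
    unfolding similar_mat_def using UU A U
    by (intro exI[of _ U] exI[of _ "mat_adjoint U"] similar_mat_witI[of _ _ n]) auto
  then have "char_poly (mat_adjoint A * A) = char_poly ?D"
    by (rule char_poly_similar)
  also have "\<dots> = (\<Prod>a\<leftarrow>diag_mat ?D. [:- a, 1:])"
    by (rule char_poly_upper_triangular[of _ n]) (auto simp: mat_diag_def)
  also have "diag_mat ?D = map (\<lambda>i. of_real ((s i)\<^sup>2)) [0..<n]"
    by (auto simp: diag_mat_def mat_diag_def intro!: map_cong)
  finally show ?thesis
    by (simp add: proots_linear_factors atLeast0LessThan[symmetric] del: map_map)
qed

end

section \<open>Rank and the smallest nonzero singular value\<close>

lemma full_column_rank:
  fixes Z :: "complex mat"
  assumes Z: "Z \<in> carrier_mat m r" and B: "B \<in> carrier_mat r m" and BZ: "B * Z = 1\<^sub>m r"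
  shows "vec_space.rank m Z = r" and "r \<le> m"
proof -
  interpret vec_space "TYPE(complex)" m .
  \<comment> \<open>Linear independence is stated for the set of columns, which does not see
    repetitions, so distinctness is proved separately.\<close>
  have dist: "distinct (cols Z)"
  proof (unfold distinct_conv_nth, intro allI impI)
    fix i j assume "i < length (cols Z)" "j < length (cols Z)" "i \<noteq> j"
    then have ij: "i < r" "j < r" using Z by auto
    have "col (1\<^sub>m r) i \<noteq> (col (1\<^sub>m r) j :: complex vec)"
      using ij \<open>i \<noteq> j\<close> by (auto simp: unit_vec_eq)
    then show "cols Z ! i \<noteq> cols Z ! j"
      using ij Z B unfolding BZ[symmetric] by (auto simp: col_mult2[of _ r m _ r])
  qed
  have indpt: "lin_indpt (set (cols Z))"
  proof
    assume "lin_dep (set (cols Z))"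
    then obtain u where u: "u \<in> carrier_vec r" "u \<noteq> 0\<^sub>v r" "Z *\<^sub>v u = 0\<^sub>v m"
      using lin_depE[OF Z _ dist] by blast
    have "u = (B * Z) *\<^sub>v u"
      using u by (simp add: BZ)
    also have "\<dots> = B *\<^sub>v 0\<^sub>v m"
      using u B Z by (simp add: assoc_mult_mat_vec[of _ r m _ r])
    also have "\<dots> = 0\<^sub>v r"
      using B by (intro eq_vecI) auto
    finally show False using u by simp
  qed
  show "rank Z = r"
    by (rule lin_indpt_full_rank[OF Z dist indpt])
  have "set (cols Z) \<subseteq> carrier_vec m"
    using cols_dim[of Z] Z by simp
  then have "card (set (cols Z)) \<le> dim"
    using li_le_dim(2)[OF fin_dim _ indpt] by simp
  then show "r \<le> m"
    using Z dist by (simp add: distinct_card dim_is_n)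
qed

text \<open>Each factorisation gives one inclusion of column spaces. This lets a matrix with
  orthonormal columns stand in for \<open>A\<close> when its rank is computed.\<close>

lemma rank_eq_if_mutual_right_multiples:
  fixes A B :: "complex mat"
  assumes A: "A \<in> carrier_mat m n" and B: "B \<in> carrier_mat m r"
    and C: "C \<in> carrier_mat r n" and D: "D \<in> carrier_mat n r"
    and eq: "A = B * C" "B = A * D"
  shows "vec_space.rank m A = vec_space.rank m B"
proof -
  interpret vec_space "TYPE(complex)" m .
  have sub: "col_space A \<subseteq> col_space B" if A: "A \<in> carrier_mat m n" and B: "B \<in> carrier_mat m r"
    and C: "C \<in> carrier_mat r n" and eq: "A = B * C" for A B C :: "complex mat" and n r
  proof
    fix y assume "y \<in> col_space A"
    then obtain x where "x \<in> carrier_vec n" "A *\<^sub>v x = y" "y \<in> carrier_vec m"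
      using col_space_eq[OF A] A by auto
    then have "C *\<^sub>v x \<in> carrier_vec r" "B *\<^sub>v (C *\<^sub>v x) = y"
      using B C eq by (auto simp: assoc_mult_mat_vec[of _ m r _ n])
    then show "y \<in> col_space B"
      using col_space_eq[OF B] B \<open>y \<in> carrier_vec m\<close> by auto
  qed
  have "col_space A = col_space B"
    using sub[OF A B C eq(1)] sub[OF B A D eq(2)] by blast
  then show ?thesis
    by (simp add: rank_def col_space_def)
qed

text \<open>Zeros, being the least possible entries, can only stand at the end.\<close>

lemma filter_nonzero_eq_takeWhile:
  fixes xs :: "real list"
  assumes "sorted_wrt (\<ge>) xs" "\<forall>x\<in>set xs. 0 \<le> x"
  shows "filter (\<lambda>x. x \<noteq> 0) xs = takeWhile (\<lambda>x. x \<noteq> 0) xs"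
  using assms
proof (induction xs)
  case (Cons x xs)
  show ?case
  proof (cases "x = 0")
    case True
    then have "\<forall>y\<in>set xs. y = 0"
      using Cons.prems by (auto intro: antisym)
    with True show ?thesis by simp
  qed (use Cons in auto)
qed simp

text \<open>The nonzero entries form a prefix of length \<open>r\<close>, so the last of them, at
  index \<open>r - 1\<close>, is the smallest.\<close>

lemma nth_least_nonzero:
  fixes xs :: "real list"
  assumes xs: "sorted_wrt (\<ge>) xs" "\<forall>x\<in>set xs. 0 \<le> x"
    and r: "length (filter (\<lambda>x. x \<noteq> 0) xs) = r" "1 \<le> r"
  shows "0 < xs ! (r - 1)" and "\<And>x. x \<in> set xs \<Longrightarrow> x \<noteq> 0 \<Longrightarrow> xs ! (r - 1) \<le> x"
proof -
  let ?ys = "takeWhile (\<lambda>x. x \<noteq> 0) xs"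
  have ys: "filter (\<lambda>x. x \<noteq> 0) xs = ?ys"
    by (rule filter_nonzero_eq_takeWhile[OF xs])
  have len: "length ?ys = r"
    using r(1) ys by simp
  have nth: "?ys ! i = xs ! i" if "i < r" for i
    using that len by (simp add: takeWhile_nth)
  have "r \<le> length xs"
    using length_takeWhile_le[of "\<lambda>x. x \<noteq> 0" xs] len by simp
  have "?ys ! (r - 1) \<in> set ?ys"
    using len r(2) by (intro nth_mem) simp
  then have "xs ! (r - 1) \<in> set xs" "xs ! (r - 1) \<noteq> 0"
    using nth[of "r - 1"] r(2) by (auto dest: set_takeWhileD)
  then show "0 < xs ! (r - 1)"
    using xs(2) by (simp add: order_less_le)
  fix x assume "x \<in> set xs" "x \<noteq> 0"
  then have "x \<in> set ?ys"
    by (auto simp flip: ys)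
  then obtain i where i: "i < r" "x = xs ! i"
    using len nth by (auto simp: in_set_conv_nth)
  then show "xs ! (r - 1) \<le> x"
    using sorted_wrt_nth_less[OF xs(1), of i "r - 1"] \<open>r \<le> length xs\<close>
    by (cases "i = r - 1") auto
qed

context svd begin

text \<open>The columns of \<open>J\<close> are the unit vectors for the indices with
  \<open>s i \<noteq> 0\<close>, so \<open>Z = Y J\<close> is \<open>Y\<close> without its zero
  columns. The columns of \<open>Z\<close> are orthonormal and span the column space of
  \<open>A\<close>.\<close>

lemma mat_rank_eq: "mat_rank A = card {i. i < n \<and> s i \<noteq> 0}" and mat_rank_le: "mat_rank A \<le> m"
proof -
  define I where "I = filter (\<lambda>i. s i \<noteq> 0) [0..<n]"
  define r where "r = length I"
  have dist: "distinct I" and set_I: "set I = {i. i < n \<and> s i \<noteq> 0}"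
    by (auto simp: I_def)
  then have r: "r = card {i. i < n \<and> s i \<noteq> 0}"
    using distinct_card[OF dist] by (simp add: r_def)
  have nth_I: "I ! a < n" if "a < r" for a
    using that nth_mem[of a I] set_I by (auto simp: r_def)
  let ?S = "mat_diag n (\<lambda>i. complex_of_real (s i))"
    and ?T = "mat_diag n (\<lambda>i. inverse (complex_of_real (s i)))"
    and ?E = "mat_diag n (\<lambda>i. of_bool (s i \<noteq> 0)) :: complex mat"
  define J where "J = mat n r (\<lambda>(i, a). of_bool (i = I ! a) :: complex)"
  have J: "J \<in> carrier_mat n r" by (simp add: J_def)
  have JJ: "transpose_mat J * J = 1\<^sub>m r"
  proof (rule eq_matI)
    fix a b assume "a < dim_row (1\<^sub>m r :: complex mat)" "b < dim_col (1\<^sub>m r :: complex mat)"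
    then have ab: "a < r" "b < r" by auto
    have "(transpose_mat J * J) $$ (a, b) = (\<Sum>i<n. if i = I ! a then of_bool (I ! a = I ! b) else 0)"
      using ab by (auto simp: J_def scalar_prod_def atLeast0LessThan intro!: sum.cong)
    also have "\<dots> = of_bool (a = b)"
      using ab nth_I dist by (auto simp: r_def nth_eq_iff_index_eq)
    finally show "(transpose_mat J * J) $$ (a, b) = 1\<^sub>m r $$ (a, b)"
      using ab by simp
  qed (simp_all add: J_def)
  have JJ': "J * transpose_mat J = ?E"
  proof (rule eq_matI)
    fix i j assume "i < dim_row ?E" "j < dim_col ?E"
    then have ij: "i < n" "j < n" by auto
    have "(J * transpose_mat J) $$ (i, j) = (\<Sum>a<r. of_bool (i = I ! a) * of_bool (j = I ! a))"
      using ij by (simp add: J_def scalar_prod_def atLeast0LessThan)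
    also have "\<dots> = (\<Sum>x\<in>set I. of_bool (i = x) * of_bool (j = x))"
      by (rule sum.reindex_bij_betw[OF bij_betw_nth[OF dist]]) (auto simp: r_def)
    also have "\<dots> = (\<Sum>x\<in>set I. if x = i then of_bool (i = j) else 0)"
      by (rule sum.cong) auto
    also have "\<dots> = ?E $$ (i, j)"
      using ij by (simp add: set_I mat_diag_def)
    finally show "(J * transpose_mat J) $$ (i, j) = ?E $$ (i, j)" .
  qed (simp_all add: J_def)
  define Z where "Z = Y * J"
  have Z: "Z \<in> carrier_mat m r"
    using Y J by (simp add: Z_def)
  note dims = dims carrier_matD[OF J] carrier_matD[OF Z]
  have ST: "?S * ?T = ?E"
    unfolding mat_diag_diag by (auto intro!: arg_cong[of _ _ "mat_diag n"])
  have adjJ: "mat_adjoint J = transpose_mat J"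
    by (rule eq_matI) (auto simp: J_def)
  have "mat_adjoint Z * Z = transpose_mat J * (mat_adjoint Y * Y * J)"
    using dims by (simp add: Z_def mat_adjoint_mult mult_mat_assoc adjJ)
  also have "\<dots> = 1\<^sub>m r"
    using dims unfolding YY JJ'[symmetric] by (simp add: mult_mat_assoc JJ)
  finally have ZZ: "mat_adjoint Z * Z = 1\<^sub>m r" .
  \<comment> \<open>The first factorisation rests on \<open>Y J J^T = Y E = Y\<close>; in the
    second, \<open>S T = E\<close> and \<open>Y E = Y\<close> undo the scaling by
    \<open>S\<close>.\<close>
  have "A = Z * (transpose_mat J * (?S * mat_adjoint U))"
    using dims by (simp add: A_eq Z_def mult_mat_assoc mult_mat_cancel[OF JJ'] mult_mat_cancel[OF YE])
  moreover have "Z = A * (U * (?T * J))"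
    using dims by (simp add: A_eq Z_def mult_mat_assoc mult_mat_cancel[OF UU(1)] mult_mat_cancel[OF ST]
        mult_mat_cancel[OF YE] del: mat_diag_diag)
  ultimately have "vec_space.rank m A = vec_space.rank m Z"
    using dims by (intro rank_eq_if_mutual_right_multiples[OF A Z]) (auto intro!: carrier_matI)
  then show "mat_rank A = card {i. i < n \<and> s i \<noteq> 0}" "mat_rank A \<le> m"
    using full_column_rank[OF Z _ ZZ] Z dims r by (simp_all add: mat_rank_def)
qed

text \<open>Sorting \<open>s\<close> in non-increasing order puts exactly \<open>mat_rank A\<close>
  nonzero values in front, so the position \<open>mat_rank A\<close>, counted from 1, holds the
  least of them.\<close>

lemma singular_value_rank:
  assumes "1 \<le> mat_rank A"
  shows "0 < singular_value A (mat_rank A)"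
    and "\<And>i. i < n \<Longrightarrow> s i \<noteq> 0 \<Longrightarrow> singular_value A (mat_rank A) \<le> s i"
proof -
  define r where "r = mat_rank A"
  define M where "M = image_mset s (mset_set {..<n})"
  define xs where "xs = rev (sorted_list_of_multiset M)"
  have "image_mset (\<lambda>z. sqrt (Re z)) (proots (char_poly (mat_adjoint A * A))) = M"
    unfolding proots_char_poly_gram M_def
    by (auto simp: multiset.map_comp comp_def s_nonneg intro!: image_mset_cong)
  then have sv: "singular_values A = take (min m n) xs"
    using dims by (simp add: singular_values_def xs_def)
  have mset_xs: "mset xs = M" by (simp add: xs_def)
  have set_xs: "set xs = s ` {..<n}"
    using arg_cong[OF mset_xs, of set_mset] by (simp add: M_def)
  have "length (filter (\<lambda>x. x \<noteq> 0) xs) = size (filter_mset (\<lambda>x. x \<noteq> 0) M)"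
    by (metis mset_filter mset_xs size_mset)
  also have "\<dots> = r"
    by (simp add: M_def filter_mset_image_mset r_def mat_rank_eq conj_commute Collect_conj_eq)
  finally have len: "length (filter (\<lambda>x. x \<noteq> 0) xs) = r" .
  have xs: "sorted_wrt (\<ge>) xs" "\<forall>x\<in>set xs. 0 \<le> x"
    using s_nonneg by (auto simp: xs_def sorted_wrt_rev) (auto simp: M_def)
  \<comment> \<open>This keeps index \<open>r - 1\<close> inside the part that survives the
    truncation in \<open>singular_values\<close>.\<close>
  have "r \<le> min m n"
    using mat_rank_le card_mono[of "{..<n}" "{i. i < n \<and> s i \<noteq> 0}"]
    by (auto simp: r_def mat_rank_eq)
  then have "r - 1 < min m n"
    using assms unfolding r_def by linarith
  then have "singular_value A r = xs ! (r - 1)"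
    by (simp only: singular_value_def sv nth_take)
  then show "0 < singular_value A (mat_rank A)"
    "\<And>i. i < n \<Longrightarrow> s i \<noteq> 0 \<Longrightarrow> singular_value A (mat_rank A) \<le> s i"
    using nth_least_nonzero[OF xs len] assms by (auto simp: r_def set_xs)
qed

lemma frob_norm_mult_pseudoinverse_le:
  assumes R: "R \<in> carrier_mat q m" and rank: "1 \<le> mat_rank A"
  shows "frob_norm (R * transpose_mat (pseudoinverse A))
    \<le> inverse (singular_value A (mat_rank A)) * frob_norm R"
proof -
  let ?T = "mat_diag n (\<lambda>i. inverse (complex_of_real (s i)))"
    and ?E = "mat_diag n (\<lambda>i. of_bool (s i \<noteq> 0)) :: complex mat"
  define \<sigma> where "\<sigma> = singular_value A (mat_rank A)"
  note \<sigma> = singular_value_rank[OF rank, folded \<sigma>_def]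
  \<comment> \<open>The entrywise conjugate of \<open>Y\<close>: transposing the pseudoinverse
    \<open>U T Y^H\<close> gives \<open>C T U^T\<close>, and the unitary factor \<open>U^T\<close>
    does not affect the norm.\<close>
  define C where "C = transpose_mat (mat_adjoint Y)"
  note dims = dims carrier_matD[OF R]
  have C: "dim_row C = m" "dim_col C = n"
    using dims by (simp_all add: C_def)
  have C_adj: "mat_adjoint C = transpose_mat Y"
    by (simp add: C_def mat_adjoint_transpose)
  have UU': "transpose_mat U * transpose_mat (mat_adjoint U) = 1\<^sub>m n"
    using arg_cong[OF UU(1), of transpose_mat] dims by (simp add: transpose_mult')
  have "frob_norm (R * transpose_mat (pseudoinverse A)) = frob_norm (R * C * ?T)"
    unfolding pseudoinverse_eq using dims C
    by (intro frob_norm_cong)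
      (simp add: mat_algebra mult_mat_cancel[OF UU'] del: mat_diag_diag flip: C_def)
  also have "\<dots> \<le> inverse \<sigma> * frob_norm (R * C)"
  proof (rule frob_norm_mono)
    fix i j assume "i < dim_row (R * C)" "j < dim_col (R * C)"
    then have ij: "i < q" "j < n" using dims C by auto
    have "(R * C * ?T) $$ (i, j) = (R * C) $$ (i, j) * inverse (of_real (s j))"
      using ij dims C by (subst mat_diag_mult_right[of _ q n]) auto
    then have "cmod ((R * C * ?T) $$ (i, j)) = inverse (s j) * cmod ((R * C) $$ (i, j))"
      using s_nonneg[OF ij(2)] by (simp add: norm_mult norm_inverse)
    \<comment> \<open>For \<open>s j = 0\<close> the left side is 0 by convention; otherwise
      \<sigma> is at most \<open>s j\<close>.\<close>
    also have "inverse (s j) \<le> inverse \<sigma>"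
      using \<sigma>(1) \<sigma>(2)[OF ij(2)] by (cases "s j = 0") (auto intro: le_imp_inverse_le)
    finally show "cmod ((R * C * ?T) $$ (i, j)) \<le> inverse \<sigma> * cmod ((R * C) $$ (i, j))"
      by (simp add: mult_right_mono)
  qed (use dims C \<sigma>(1) in auto)
  also have "frob_norm (R * C) \<le> frob_norm R"
  proof -
    have E: "transpose_mat ?E = ?E" "mat_adjoint ?E = ?E"
      by (auto simp: transpose_diag mat_adjoint_diag of_bool_def intro!: arg_cong[of _ _ "mat_diag n"])
    have CC: "mat_adjoint C * C = ?E"
      unfolding C_adj using arg_cong[OF YY, of transpose_mat] dims
      by (simp add: C_def transpose_mult' E)
    have CE: "C * ?E = C"
      using arg_cong[OF YE, of "\<lambda>A. transpose_mat (mat_adjoint A)"] dims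
      by (simp add: C_def mat_adjoint_mult transpose_mult' E)
    \<comment> \<open>\<open>C^H C = E\<close> and \<open>C E = C\<close> make \<open>C\<close> a
      partial isometry, so \<open>C C^H\<close> is an orthogonal projection and \<open>R C\<close>
      has the norm of \<open>R C C^H\<close>.\<close>
    let ?P = "C * mat_adjoint C"
    have proj: "?P * ?P = ?P" "mat_adjoint ?P = ?P"
      using C by (simp_all add: mat_adjoint_mult mult_mat_assoc mult_mat_cancel[OF CC] mult_mat_cancel[OF CE])
    have "frob_norm (R * C) = frob_norm (R * ?P)"
      using dims C
      by (intro frob_norm_cong)
        (simp add: mat_adjoint_mult mult_mat_assoc mult_mat_cancel[OF CC] mult_mat_cancel[OF CE])
    also have "\<dots> \<le> frob_norm R"
      using dims C by (intro frob_norm_projection_le[OF R _ proj]) (auto intro!: carrier_matI)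
    finally show ?thesis .
  qed
  finally show ?thesis
    using \<sigma>(1) by (simp add: \<sigma>_def)
qed

end

section \<open>Backward errors\<close>

lemma frob_norm_uminus [simp]: "frob_norm (- A) = frob_norm A"
  by (simp add: frob_norm_def)

text \<open>\<open>K\<close> is the Khatri-Rao transpose product of the theorem, given by its entries.\<close>

locale eigenpairs =
  fixes n k p :: nat and f :: "nat \<Rightarrow> complex \<Rightarrow> complex" and lam :: "nat \<Rightarrow> complex"
    and v :: "nat \<Rightarrow> complex vec" and K :: "complex mat"
  assumes v: "\<And>i. i < p \<Longrightarrow> v i \<in> carrier_vec n"
    and K: "K = mat p (k * n) (\<lambda>(i, c). f (c div n) (lam i) * v i $ (c mod n))"
begin

text \<open>Writing the column index as \<open>c = j * n + s\<close> splits the sum over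
  \<open>c\<close> into \<open>k\<close> blocks of length \<open>n\<close>.\<close>

lemma block_row_mult_index:
  assumes "r < n" "i < p"
  shows "(block_row n k D * transpose_mat K) $$ (r, i)
    = (\<Sum>j<k. f j (lam i) * (\<Sum>s<n. D j $$ (r, s) * v i $ s))"
proof -
  define g where "g c = D (c div n) $$ (r, c mod n) * (f (c div n) (lam i) * v i $ (c mod n))" for c
  have "(block_row n k D * transpose_mat K) $$ (r, i) = (\<Sum>c<k * n. g c)"
    using assms by (auto simp: block_row_def K g_def scalar_prod_def atLeast0LessThan intro!: sum.cong)
  also have "\<dots> = (\<Sum>j<k. sum g {j * n..<j * n + n})"
    by (simp add: sum.nat_group)
  also have "\<dots> = (\<Sum>j<k. \<Sum>s<n. g (j * n + s))"
    by (simp add: sum.atLeastLessThan_shift_0 atLeast0LessThan)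
  also have "\<dots> = (\<Sum>j<k. \<Sum>s<n. D j $$ (r, s) * (f j (lam i) * v i $ s))"
    by (intro sum.cong) (auto simp: g_def)
  finally show ?thesis
    by (simp add: sum_distrib_left mult.left_commute)
qed

text \<open>The diagonal factor scales column \<open>i\<close> by \<open>f j (lam i)\<close>, so
  column \<open>i\<close> of either side is the residual \<open>F(lam i) v i\<close>.\<close>

lemma residual_eq_block_row:
  assumes F: "\<And>j. j < k \<Longrightarrow> F j \<in> carrier_mat n n"
  shows "mat_sum n p k (\<lambda>j. F j * mat_of_cols n (map v [0..<p]) * fun_of_diag (f j) (mat_diag p lam))
    = block_row n k F * transpose_mat K" (is "?R = _")
proof (rule eq_matI)
  fix r i assume "r < dim_row (block_row n k F * transpose_mat K)"
    "i < dim_col (block_row n k F * transpose_mat K)"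
  then have ri: "r < n" "i < p" by (simp_all add: block_row_def K)
  let ?V = "mat_of_cols n (map v [0..<p])"
  have V: "?V \<in> carrier_mat n p"
    using mat_of_cols_carrier(1)[of n "map v [0..<p]"] by simp
  have "(F j * ?V * fun_of_diag (f j) (mat_diag p lam)) $$ (r, i)
      = f j (lam i) * (\<Sum>s<n. F j $$ (r, s) * v i $ s)" if "j < k" for j
  proof -
    have "(F j * ?V) $$ (r, i) = (\<Sum>s<n. F j $$ (r, s) * v i $ s)"
      using ri F[OF that] V v[OF ri(2)]
      by (auto simp: scalar_prod_def atLeast0LessThan mat_of_cols_index intro!: sum.cong)
    then show ?thesis
      using ri F[OF that] V
      by (simp add: fun_of_diag_def mat_diag_mult_right[of _ n p] del: index_mult_mat(1))
        (simp add: mat_diag_def mult.commute)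
  qed
  then show "?R $$ (r, i) = (block_row n k F * transpose_mat K) $$ (r, i)"
    using ri by (simp add: mat_sum_def block_row_mult_index)
qed (simp_all add: mat_sum_def block_row_def K)

text \<open>By linearity the vector in constraint \<open>i\<close> is the sum of the
  \<open>i\<close>-th columns of the two products, so the \<open>p\<close> constraints are the
  columns of one matrix equation.\<close>

lemma constraint_iff:
  assumes F: "\<And>j. j < k \<Longrightarrow> F j \<in> carrier_mat n n" and D: "\<And>j. j < k \<Longrightarrow> D j \<in> carrier_mat n n"
  shows "(\<forall>i<p. matrix_function n k f (\<lambda>j. F j + D j) (lam i) *\<^sub>v v i = 0\<^sub>v n)
    \<longleftrightarrow> block_row n k D * transpose_mat K = - (block_row n k F * transpose_mat K)"
proof -
  have entry: "(matrix_function n k f (\<lambda>j. F j + D j) (lam i) *\<^sub>v v i) $ r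
      = (block_row n k F * transpose_mat K) $$ (r, i) + (block_row n k D * transpose_mat K) $$ (r, i)"
    if ri: "r < n" "i < p" for r i
  proof -
    have "(matrix_function n k f (\<lambda>j. F j + D j) (lam i) *\<^sub>v v i) $ r
        = (\<Sum>s<n. (\<Sum>j<k. f j (lam i) * (F j $$ (r, s) + D j $$ (r, s))) * v i $ s)"
      using ri v[OF ri(2)] F D
      by (auto simp: matrix_function_def mat_sum_def scalar_prod_def atLeast0LessThan
          carrier_matD[OF F] carrier_matD[OF D] intro!: sum.cong)
    also have "\<dots> = (\<Sum>j<k. \<Sum>s<n. f j (lam i) * (F j $$ (r, s) + D j $$ (r, s)) * v i $ s)"
      by (subst sum.swap) (simp add: sum_distrib_right)
    also have "\<dots> = (\<Sum>j<k. f j (lam i) * (\<Sum>s<n. F j $$ (r, s) * v i $ s))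
        + (\<Sum>j<k. f j (lam i) * (\<Sum>s<n. D j $$ (r, s) * v i $ s))"
      by (simp only: sum_distrib_left sum.distrib[symmetric] distrib_left distrib_right mult.assoc)
    finally show ?thesis
      using ri by (simp only: block_row_mult_index)
  qed
  have "matrix_function n k f (\<lambda>j. F j + D j) (lam i) *\<^sub>v v i = 0\<^sub>v n
    \<longleftrightarrow> (\<forall>r<n. (block_row n k D * transpose_mat K) $$ (r, i)
          = - (block_row n k F * transpose_mat K) $$ (r, i))" (is "?w = _ \<longleftrightarrow> _") if "i < p" for i
  proof -
    have "dim_vec ?w = n"
      by (simp add: matrix_function_def mat_sum_def)
    then have "?w = 0\<^sub>v n \<longleftrightarrow> (\<forall>r<n. ?w $ r = 0)"
      by (auto simp only: vec_eq_iff index_zero_vec)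
    moreover have "?w $ r = 0 \<longleftrightarrow> (block_row n k D * transpose_mat K) $$ (r, i)
          = - (block_row n k F * transpose_mat K) $$ (r, i)" if "r < n" for r
      unfolding entry[OF that \<open>i < p\<close>] by (rule add_eq_0_iff)
    ultimately show ?thesis
      by blast
  qed
  then have "(\<forall>i<p. matrix_function n k f (\<lambda>j. F j + D j) (lam i) *\<^sub>v v i = 0\<^sub>v n)
    \<longleftrightarrow> (\<forall>i<p. \<forall>r<n. (block_row n k D * transpose_mat K) $$ (r, i)
          = - (block_row n k F * transpose_mat K) $$ (r, i))"
    by simp
  also have "\<dots> \<longleftrightarrow> block_row n k D * transpose_mat K = - (block_row n k F * transpose_mat K)"
    by (auto simp: mat_eq_iff block_row_def K simp del: index_mult_mat(1))
  finally show ?thesis .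
qed

text \<open>Cutting a matrix into blocks shows that \<open>block_row\<close> reaches every matrix of
  its shape. The family \<open>D\<close> can thus be traded for one unknown \<Delta>, which leaves a
  least-norm problem for a linear matrix equation.\<close>

lemma perturbation_norms_eq:
  assumes F: "\<And>j. j < k \<Longrightarrow> F j \<in> carrier_mat n n"
  shows "perturbation_norms n k p f F lam v = {frob_norm \<Delta> | \<Delta>.
    \<Delta> \<in> carrier_mat n (k * n) \<and> \<Delta> * transpose_mat K = - (block_row n k F * transpose_mat K)}"
proof -
  have surj: "\<exists>D. (\<forall>j<k. D j \<in> carrier_mat n n) \<and> \<Delta> = block_row n k D"
    if "\<Delta> \<in> carrier_mat n (k * n)" for \<Delta>
  proof (intro exI[of _ "\<lambda>j. mat n n (\<lambda>(r, s). \<Delta> $$ (r, j * n + s))"] conjI eq_matI)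
    fix r c assume "r < dim_row (block_row n k (\<lambda>j. mat n n (\<lambda>(r, s). \<Delta> $$ (r, j * n + s))))"
      "c < dim_col (block_row n k (\<lambda>j. mat n n (\<lambda>(r, s). \<Delta> $$ (r, j * n + s))))"
    then have "r < n" "c < k * n" by (simp_all add: block_row_def)
    \<comment> \<open>\<open>c < k * n\<close> excludes \<open>n = 0\<close>, where
      \<open>c mod n\<close> would be \<open>c\<close>.\<close>
    moreover from this have "c mod n < n" by (cases "n = 0") auto
    ultimately show "\<Delta> $$ (r, c) = block_row n k (\<lambda>j. mat n n (\<lambda>(r, s). \<Delta> $$ (r, j * n + s))) $$ (r, c)"
      by (simp add: block_row_def)
  qed (use that in \<open>auto simp: block_row_def\<close>)
  have carrier: "block_row n k D \<in> carrier_mat n (k * n)" for D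
    by (simp add: block_row_def)
  show ?thesis (is "_ = ?S")
  proof (intro equalityI subsetI)
    fix x assume "x \<in> perturbation_norms n k p f F lam v"
    then obtain D where "\<And>j. j < k \<Longrightarrow> D j \<in> carrier_mat n n" "x = frob_norm (block_row n k D)"
      "\<forall>i<p. matrix_function n k f (\<lambda>j. F j + D j) (lam i) *\<^sub>v v i = 0\<^sub>v n"
      unfolding perturbation_norms_def by blast
    then show "x \<in> ?S"
      using constraint_iff[of F D, OF F] carrier unfolding mem_Collect_eq by metis
  next
    fix x assume "x \<in> ?S"
    then obtain \<Delta> where \<Delta>: "\<Delta> \<in> carrier_mat n (k * n)" "x = frob_norm \<Delta>"
      "\<Delta> * transpose_mat K = - (block_row n k F * transpose_mat K)"
      unfolding mem_Collect_eq by metis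
    obtain D where D: "\<forall>j<k. D j \<in> carrier_mat n n" "\<Delta> = block_row n k D"
      using surj[OF \<Delta>(1)] by blast
    then show "x \<in> perturbation_norms n k p f F lam v"
      unfolding perturbation_norms_def mem_Collect_eq
      using \<Delta> constraint_iff[of F D, OF F] by (intro exI[of _ D]) simp
  qed
qed

end

text \<open>Supplies the entry formula by which the locale \<open>eigenpairs\<close> describes
  \<open>K\<close>.\<close>

lemma khatri_rao_T_eq:
  assumes v: "\<And>i. i < p \<Longrightarrow> v i \<in> carrier_vec n"
  shows "khatri_rao_T (mat p k (\<lambda>(i, j). f j (lam i))) (transpose_mat (mat_of_cols n (map v [0..<p])))
    = mat p (k * n) (\<lambda>(i, c). f (c div n) (lam i) * v i $ (c mod n))"
proof (rule eq_matI)
  fix i c assume "i < dim_row (mat p (k * n) (\<lambda>(i, c). f (c div n) (lam i) * v i $ (c mod n)))"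
    "c < dim_col (mat p (k * n) (\<lambda>(i, c). f (c div n) (lam i) * v i $ (c mod n)))"
  then have ic: "i < p" "c < k * n" by auto
  then have "c div n < k"
    by (simp add: less_mult_imp_div_less)
  moreover have "c mod n < n"
    using ic(2) by (cases "n = 0") auto
  ultimately show "khatri_rao_T (mat p k (\<lambda>(i, j). f j (lam i)))
      (transpose_mat (mat_of_cols n (map v [0..<p]))) $$ (i, c)
    = mat p (k * n) (\<lambda>(i, c). f (c div n) (lam i) * v i $ (c mod n)) $$ (i, c)"
    using ic v[OF ic(1)] by (simp add: khatri_rao_T_def kron_vec_def mat_of_rows_index mat_of_cols_index)
qed (simp_all add: khatri_rao_T_def)

text \<open>The first conjunct certifies that \<open>LEAST\<close> in \<open>backward_error\<close>
  is a true minimum, so the two statements about \<eta> have their intended meaning.\<close>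

theorem theorem2p3:
  fixes n k p :: nat
    and f :: "nat \<Rightarrow> complex \<Rightarrow> complex"
    and F :: "nat \<Rightarrow> complex mat"
    and lam :: "nat \<Rightarrow> complex"
    and v :: "nat \<Rightarrow> complex vec"
    and G V Lam K R :: "complex mat"
    and \<eta> :: real
    and p_hat :: nat
  assumes F: "\<And>j. j < k \<Longrightarrow> F j \<in> carrier_mat n n"
    and v: "\<And>i. i < p \<Longrightarrow> v i \<in> carrier_vec n"
    and v_nonzero: "\<And>i. i < p \<Longrightarrow> v i \<noteq> 0\<^sub>v n"
    and G: "G = Matrix.mat p k (\<lambda>(i, j). f j (lam i))"
    and V: "V = mat_of_cols n (map v [0..<p])"
    and Lam: "Lam = mat_diag p lam"
    and K: "K = khatri_rao_T G (transpose_mat V)"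
    and R: "R = mat_sum n p k (\<lambda>j. F j * V * fun_of_diag (f j) Lam)"
    and \<eta>: "\<eta> = backward_error n k p f F lam v"
    and p_hat: "p_hat = mat_rank K"
  shows "(\<eta> \<in> perturbation_norms n k p f F lam v \<and>
          (\<forall>x \<in> perturbation_norms n k p f F lam v. \<eta> \<le> x)) \<and>
         \<eta> = frob_norm (R * transpose_mat (pseudoinverse K)) \<and>
         (1 \<le> p_hat \<longrightarrow> \<eta> \<le> inverse (singular_value K p_hat) * frob_norm R)"
proof -
  interpret eigenpairs n k p f lam v K
    by unfold_locales (use v in \<open>simp_all add: K G V khatri_rao_T_eq\<close>)
  have K_carrier: "K \<in> carrier_mat p (k * n)"
    by (simp add: eigenpairs.K[OF eigenpairs_axioms])
  obtain Y U s where "svd p (k * n) K Y U s"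
    using svd_exists[OF K_carrier] by blast
  then interpret svd p "k * n" K Y U s .
  define B where "B = block_row n k F"
  have R_eq: "R = B * transpose_mat K"
    unfolding R V Lam B_def by (rule residual_eq_block_row[OF F])
  define X where "X = pseudoinverse K"
  have X: "X \<in> carrier_mat (k * n) p" "K * X * K = K" "X * K * X = X" "mat_adjoint (X * K) = X * K"
    using is_pseudoinverse K_carrier by (auto simp: is_pseudoinverse_def X_def)
  have dims: "dim_row K = p" "dim_col K = k * n" "dim_row X = k * n" "dim_col X = p"
    "dim_row B = n" "dim_col B = k * n"
    using K_carrier X(1) by (auto simp: B_def block_row_def)
  let ?S = "perturbation_norms n k p f F lam v"
  have S_eq: "?S = {frob_norm \<Delta> | \<Delta>. \<Delta> \<in> carrier_mat n (k * n) \<and> \<Delta> * transpose_mat K = - R}"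
    using perturbation_norms_eq[of F] F unfolding R_eq B_def by blast
  have "frob_norm (R * transpose_mat X) \<in> ?S"
  proof -
    let ?\<Delta> = "- (R * transpose_mat X)"
    \<comment> \<open>The equation is solvable because \<open>R = B K^T\<close>:
      \<open>R X^T K^T = B (K X K)^T = B K^T = R\<close>.\<close>
    have "R * (transpose_mat X * transpose_mat K) = R"
      using arg_cong[OF X(2), of transpose_mat] dims by (simp add: R_eq transpose_mult' mult_mat_assoc)
    then have "?\<Delta> * transpose_mat K = - R"
      using dims by (simp add: R_eq mult_mat_assoc)
    moreover have "?\<Delta> \<in> carrier_mat n (k * n)"
      using dims by (intro carrier_matI) (simp_all add: R_eq)
    ultimately show ?thesis
      unfolding S_eq mem_Collect_eq by (intro exI[of _ ?\<Delta>]) simp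
  qed
  moreover have "frob_norm (R * transpose_mat X) \<le> x" if x: "x \<in> ?S" for x
  proof -
    obtain \<Delta> where \<Delta>: "\<Delta> \<in> carrier_mat n (k * n)" "\<Delta> * transpose_mat K = - R" "x = frob_norm \<Delta>"
      using x unfolding S_eq by blast
    let ?P = "transpose_mat (X * K)"
    have "- (R * transpose_mat X) = \<Delta> * ?P"
      using \<Delta>(1) dims arg_cong[OF \<Delta>(2), of "\<lambda>A. A * transpose_mat X"]
      by (simp add: transpose_mult' mult_mat_assoc R_eq)
    then have "frob_norm (R * transpose_mat X) = frob_norm (\<Delta> * ?P)"
      by (metis frob_norm_uminus)
    also have "\<dots> \<le> frob_norm \<Delta>"
    proof (rule frob_norm_projection_le[OF \<Delta>(1)])
      \<comment> \<open>\<open>X K X = X\<close> makes \<open>X K\<close> idempotent. Transposition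
        preserves this and, since it commutes with the adjoint, also Hermitian symmetry.\<close>
      have "(X * K) * (X * K) = X * K"
        using X(3) dims by (metis mult_mat_assoc index_mult_mat(2,3))
      then show "?P * ?P = ?P"
        using dims by (metis transpose_mult' index_mult_mat(2,3))
      show "mat_adjoint ?P = ?P"
        using X(4) by (simp add: mat_adjoint_transpose)
    qed (use dims in \<open>auto intro!: carrier_matI\<close>)
    finally show ?thesis using \<Delta>(3) by simp
  qed
  moreover from calculation have "\<eta> = frob_norm (R * transpose_mat X)"
    unfolding \<eta> backward_error_def by (intro Least_equality) auto
  moreover have "R \<in> carrier_mat n p"
    using dims by (intro carrier_matI) (simp_all add: R_eq)
  ultimately show ?thesis
    using frob_norm_mult_pseudoinverse_le[of R n] by (simp add: X_def p_hat)
qed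

end
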